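(* Let $b_0,b_1,\ldots,\lambda_1,\lambda_2,\ldots$ be independent indeterminates, $\mathbb{Z}[b,\lambda]$ the polynomial ring in them, and $\mathcal L:\mathbb{Z}[b,\lambda][x]\to\mathbb{Z}[b,\lambda]$ the linear functional with $\mathcal L(x^m)=\mu_m$, where $\mu_m=\sum_\omega\mathrm{wt}(\omega)$ over all Motzkin paths $\omega$ of length $m$ with $\omega(1)=\omega(m+1)=0$. (Equivalently, $\mathcal L$ is the functional with $\mathcal L(1)=1$ for which the polynomials $p_{k+1}(x)=(x-b_k)p_k(x)-\lambda_kp_{k-1}(x)$, $p_{-1}=0$, $p_0=1$, are orthogonal.) Let $Y_0(x),\ldots,Y_n(x),Z_0(x),\ldots,Z_n(x)$ be monic polynomials over $\mathbb{Z}[b,\lambda]$ with $\deg Y_k=\deg Z_k=k$. Then the matrix $\big(\mathcal L(Y_i(x)Z_j(x))\big)_{0\leq i,j\leq n}$ has special Smith normal form $\mathrm{diag}(1,\lambda_1,\lambda_1\lambda_2,\ldots,\lambda_1\lambda_2\cdots\lambda_n)$ over $\mathbb{Z}[b,\lambda]$.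
   Context: A Motzkin path of length $m$ is a map $\omega:\{1,\ldots,m+1\}\to\{0,1,2,\ldots\}$ with $|\omega(i+1)-\omega(i)|\leq1$ for $1\leq i\leq m$; its weight is $\mathrm{wt}(\omega)=\prod_i b_{\omega(i)}\prod_j\lambda_{\omega(j)}$, the first product over $i$ with $\omega(i+1)=\omega(i)$, the second over $j$ with $\omega(j+1)-\omega(j)=-1$. For an $m\times n$ matrix $A$ over a commutative ring $R$, a matrix $D$ is a special Smith normal form (SSNF) of $A$ over $R$ if there exist $P\in \mathrm{SL}(m,R)$, $Q\in\mathrm{SL}(n,R)$ with $PAQ=D$, $D$ is diagonal, and $d_{ii}$ is a multiple in $R$ of $d_{jj}$ whenever $i\geq j$. *)

theory Defs
  imports
    "HOL-Library.Poly_Mapping"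
    "HOL-Library.FuncSet"
    "HOL-Computational_Algebra.Polynomial"
    "Jordan_Normal_Form.Determinant"
begin

text \<open>
  The ring \<open>\<int>[b,\<lambda>]\<close> in countably many indeterminates \<open>b\<^sub>0, b\<^sub>1, \<dots>, \<lambda>\<^sub>1, \<lambda>\<^sub>2, \<dots>\<close>, as the ring of
  finitely supported integer-valued functions on monomials. Since there is no \<open>\<lambda>\<^sub>0\<close>, the
  constructor \<open>Lam_ix k\<close> names \<open>\<lambda>\<^bsub>k+1\<^esub>\<close>, so that no superfluous indeterminate is adjoined.
\<close>

datatype var = B_ix nat | Lam_ix nat

type_synonym zbl = "(var \<Rightarrow>\<^sub>0 nat) \<Rightarrow>\<^sub>0 int"

definition indet :: "var \<Rightarrow> zbl" where
  "indet v = Poly_Mapping.single (Poly_Mapping.single v 1) 1"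

definition bvar :: "nat \<Rightarrow> zbl" where
  "bvar k = indet (B_ix k)"

text \<open>Only meaningful for \<open>k \<ge> 1\<close>; the value at \<open>0\<close> is never used below, since a down step of a
  path starts at a positive height.\<close>

definition lamvar :: "nat \<Rightarrow> zbl" where
  "lamvar k = indet (Lam_ix (k - 1))"

text \<open>A path of length \<open>m\<close> is a map on \<open>{1..m+1}\<close>, made unique as a HOL function by requiring it
  to be \<open>undefined\<close> outside this set.\<close>

definition motzkin_paths :: "nat \<Rightarrow> (nat \<Rightarrow> nat) set" where
  "motzkin_paths m =
     {\<omega> \<in> {1..m+1} \<rightarrow>\<^sub>E (UNIV :: nat set). \<forall>i\<in>{1..m}. \<bar>int (\<omega> (i+1)) - int (\<omega> i)\<bar> \<le> 1}"

definition wt :: "nat \<Rightarrow> (nat \<Rightarrow> nat) \<Rightarrow> zbl" where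
  "wt m \<omega> =
     (\<Prod>i\<in>{i\<in>{1..m}. \<omega> (i+1) = \<omega> i}. bvar (\<omega> i)) *
     (\<Prod>j\<in>{j\<in>{1..m}. int (\<omega> (j+1)) - int (\<omega> j) = -1}. lamvar (\<omega> j))"

definition mu :: "nat \<Rightarrow> zbl" where
  "mu m = (\<Sum>\<omega>\<in>{\<omega>\<in>motzkin_paths m. \<omega> 1 = 0 \<and> \<omega> (m+1) = 0}. wt m \<omega>)"

text \<open>The index set of this sum is finite, so the sum is not a junk value.\<close>

lemma finite_motzkin_paths_0: "finite {\<omega>\<in>motzkin_paths m. \<omega> 1 = 0 \<and> \<omega> (m+1) = 0}"
proof (rule finite_subset)
  show "{\<omega>\<in>motzkin_paths m. \<omega> 1 = 0 \<and> \<omega> (m+1) = 0} \<subseteq> {1..m+1} \<rightarrow>\<^sub>E {..m}"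
  proof
    fix \<omega> assume "\<omega> \<in> {\<omega>\<in>motzkin_paths m. \<omega> 1 = 0 \<and> \<omega> (m+1) = 0}"
    then have ext: "\<omega> \<in> {1..m+1} \<rightarrow>\<^sub>E (UNIV :: nat set)" and start: "\<omega> 1 = 0"
      and step: "\<And>i. i \<in> {1..m} \<Longrightarrow> \<bar>int (\<omega> (i+1)) - int (\<omega> i)\<bar> \<le> 1"
      by (auto simp: motzkin_paths_def)
    have bound: "i \<le> m \<Longrightarrow> \<omega> (i+1) \<le> i" for i
    proof (induction i)
      case 0
      then show ?case using start by simp
    next
      case (Suc i)
      then show ?case using step[of "i+1"] by simp
    qed
    have "\<omega> i \<in> {..m}" if "i \<in> {1..m+1}" for i
      using bound[of "i - 1"] that by (simp, linarith)
    then show "\<omega> \<in> {1..m+1} \<rightarrow>\<^sub>E {..m}"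
      using ext by (auto simp: PiE_iff)
  qed
qed (rule finite_PiE; simp)

definition Lfun :: "zbl poly \<Rightarrow> zbl" where
  "Lfun p = (\<Sum>i\<le>degree p. coeff p i * mu i)"

text \<open>\<open>Lfun\<close> is the unique \<open>\<int>[b,\<lambda>]\<close>-linear functional sending \<open>x\<^sup>m\<close> to \<open>\<mu>\<^sub>m\<close>.\<close>

lemma Lfun_altdef:
  assumes "degree p \<le> N"
  shows "Lfun p = (\<Sum>i\<le>N. coeff p i * mu i)"
  unfolding Lfun_def
  by (rule sum.mono_neutral_left) (use assms in \<open>auto simp: coeff_eq_0\<close>)

lemma Lfun_add: "Lfun (p + q) = Lfun p + Lfun q"
proof -
  let ?N = "max (degree p) (degree q)"
  have "degree (p + q) \<le> ?N" by (rule degree_add_le_max)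
  then show ?thesis
    by (simp add: Lfun_altdef[of _ ?N] sum.distrib distrib_right)
qed

lemma Lfun_smult: "Lfun (smult c p) = c * Lfun p"
proof -
  have "degree (smult c p) \<le> degree p" by (rule degree_smult_le)
  then show ?thesis
    by (simp add: Lfun_altdef[of _ "degree p"] sum_distrib_left mult.assoc)
qed

lemma Lfun_monom: "Lfun (monom 1 m) = mu m"
proof -
  have "Lfun (monom 1 m) = (\<Sum>i\<le>m. if i = m then mu i else 0)"
    unfolding Lfun_altdef[OF degree_monom_le] by (rule sum.cong) auto
  then show ?thesis by simp
qed

lemma Lfun_unique:
  assumes "\<And>p q. F (p + q) = F p + F q" and "\<And>c p. F (smult c p) = c * F p"
    and "\<And>m. F (monom 1 m) = mu m"
  shows "F = Lfun"
proof
  have monom: "F (monom c m) = Lfun (monom c m)" for c m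
    using assms(2)[of c "monom 1 m"] Lfun_smult[of c "monom 1 m"]
    by (simp add: assms(3) Lfun_monom smult_monom)
  have sums: "F (\<Sum>i\<le>N. monom (coeff p i) i) = Lfun (\<Sum>i\<le>N. monom (coeff p i) i)" for N p
    by (induction N) (simp_all add: monom assms(1) Lfun_add)
  show "F p = Lfun p" for p
    using sums[where N = "degree p" and p = p] unfolding poly_as_sum_of_monoms .
qed

definition SL :: "nat \<Rightarrow> 'a::comm_ring_1 mat set" where
  "SL n = {P \<in> carrier_mat n n. det P = 1}"

text \<open>Divisibility runs down from later to earlier diagonal entries; \<open>a dvd c\<close> says that \<open>c\<close> is a
  multiple of \<open>a\<close> in the ring given by the type.\<close>

definition is_SSNF :: "'a::comm_ring_1 mat \<Rightarrow> 'a mat \<Rightarrow> bool" where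
  "is_SSNF A D \<longleftrightarrow>
     (\<exists>P\<in>SL (dim_row A). \<exists>Q\<in>SL (dim_col A). P * A * Q = D) \<and>
     diagonal_mat D \<and>
     (\<forall>i<min (dim_row D) (dim_col D). \<forall>j\<le>i. D $$ (j,j) dvd D $$ (i,i))"

end

theory Submission
  imports Defs
begin

text \<open>
  Let \<open>J\<close> be the tridiagonal operator whose matrix entries are the weights of single steps of a
  Motzkin path, so that \<open>\<mu>\<^sub>m\<close> is the entry at \<open>0\<close> of \<open>J\<^sup>m e\<^sub>0\<close>. With \<open>\<Lambda>\<^sub>k = \<lambda>\<^sub>1 \<cdots> \<lambda>\<^sub>k\<close>, \<open>J\<close> is self-adjoint
  for the form \<open>\<langle>u, v\<rangle> = \<Sum>\<^sub>k \<Lambda>\<^sub>k u\<^sub>k v\<^sub>k\<close>, hence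
  \<open>\<L>(f g) = \<langle>f(J) g(J) e\<^sub>0, e\<^sub>0\<rangle> = \<langle>f(J) e\<^sub>0, g(J) e\<^sub>0\<rangle>\<close>. If \<open>f\<close> is monic of degree \<open>i\<close>, then \<open>f(J) e\<^sub>0\<close> has
  entry \<open>1\<close> at \<open>i\<close> and vanishes beyond, so the matrix in question is \<open>U D V\<^sup>T\<close> with \<open>D\<close> the
  diagonal matrix of the \<open>\<Lambda>\<^sub>k\<close> and lower unitriangular \<open>U\<close>, \<open>V\<close>.
\<close>

section \<open>The tridiagonal operator and its self-adjointness\<close>

text \<open>Entry \<open>k\<close> collects the steps arriving at height \<open>k\<close>: level, up
  with weight 1, and down from \<open>Suc k\<close>.\<close>

definition jacobi :: "(nat \<Rightarrow> 'a) \<Rightarrow> (nat \<Rightarrow> 'a) \<Rightarrow> (nat \<Rightarrow> 'a) \<Rightarrow> nat \<Rightarrow> 'a::comm_ring_1" where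
  "jacobi b l u k = b k * u k + (if k = 0 then 0 else u (k - 1)) + l (Suc k) * u (Suc k)"

text \<open>The truncation at \<open>N\<close> costs one boundary term on each side.\<close>

lemma jacobi_selfadjoint:
  fixes b l u v :: "nat \<Rightarrow> 'a::comm_ring_1"
  defines "\<Lambda> \<equiv> \<lambda>k. \<Prod>i=1..k. l i"
  shows "(\<Sum>k\<le>N. jacobi b l u k * \<Lambda> k * v k) + u N * \<Lambda> (Suc N) * v (Suc N)
       = (\<Sum>k\<le>N. u k * \<Lambda> k * jacobi b l v k) + u (Suc N) * \<Lambda> (Suc N) * v N"
proof (induction N)
  case 0
  then show ?case by (simp add: jacobi_def \<Lambda>_def algebra_simps)
next
  case (Suc N)
  \<comment> \<open>By this recurrence the down-step coefficient turns
    \<open>\<Lambda> (Suc N)\<close> into the new boundary weight. The equation after it compares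
    the increments of the two sides from \<open>N\<close> to \<open>Suc N\<close>.\<close>
  have "\<Lambda> (Suc (Suc N)) = l (Suc (Suc N)) * \<Lambda> (Suc N)"
    by (simp add: \<Lambda>_def mult.commute)
  then have "jacobi b l u (Suc N) * \<Lambda> (Suc N) * v (Suc N) + u (Suc N) * \<Lambda> (Suc (Suc N)) * v (Suc (Suc N))
      - u N * \<Lambda> (Suc N) * v (Suc N)
    = u (Suc N) * \<Lambda> (Suc N) * jacobi b l v (Suc N) + u (Suc (Suc N)) * \<Lambda> (Suc (Suc N)) * v (Suc N)
      - u (Suc N) * \<Lambda> (Suc N) * v N"
    by (simp add: jacobi_def algebra_simps)
  from arg_cong2[where f = "(+)", OF Suc.IH this] show ?case
    by (simp add: algebra_simps)
qed

definition jacobi_pow :: "(nat \<Rightarrow> 'a) \<Rightarrow> (nat \<Rightarrow> 'a) \<Rightarrow> nat \<Rightarrow> nat \<Rightarrow> 'a::comm_ring_1" where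
  "jacobi_pow b l m = (jacobi b l ^^ m) (\<lambda>k. if k = 0 then 1 else 0)"

lemma jacobi_pow_0: "jacobi_pow b l 0 k = (if k = 0 then 1 else 0)"
  by (simp add: jacobi_pow_def)

lemma jacobi_pow_Suc: "jacobi_pow b l (Suc m) = jacobi b l (jacobi_pow b l m)"
  by (simp add: jacobi_pow_def)

lemma jacobi_pow_above: "m < k \<Longrightarrow> jacobi_pow b l m k = 0"
  by (induction m arbitrary: k) (auto simp: jacobi_pow_0 jacobi_pow_Suc jacobi_def)

text \<open>Height \<open>m\<close> is reached in \<open>m\<close> steps only by going up each time,
  with weight 1.\<close>

lemma jacobi_pow_diag: "jacobi_pow b l m m = 1"
  by (induction m) (simp_all add: jacobi_pow_0 jacobi_pow_Suc jacobi_def jacobi_pow_above)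

text \<open>Self-adjointness moves one factor of the operator at a time from left to right, until
  the left vector is e_0 and picks out entry 0. The bound on \<open>m + j\<close> makes all boundary
  terms vanish on the way.\<close>

lemma jacobi_pow_inner_large:
  assumes "m + j \<le> N"
  shows "(\<Sum>k\<le>N. jacobi_pow b l m k * (\<Prod>i=1..k. l i) * jacobi_pow b l j k) = jacobi_pow b l (m + j) 0"
  using assms
proof (induction m arbitrary: j)
  case 0
  have "(\<Sum>k\<le>N. jacobi_pow b l 0 k * (\<Prod>i=1..k. l i) * jacobi_pow b l j k)
      = (\<Sum>k\<le>N. if k = 0 then jacobi_pow b l j 0 else 0)"
    by (intro sum.cong) (auto simp: jacobi_pow_0)
  then show ?case by simp
next
  case (Suc m)
  then show ?case
    using jacobi_selfadjoint[of b l "jacobi_pow b l m" "jacobi_pow b l j" N] Suc.IH[of "Suc j"]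
    by (simp add: jacobi_pow_Suc[symmetric] jacobi_pow_above)
qed

text \<open>Both vectors vanish beyond \<open>n\<close>, so the sum may be extended to
  \<open>n + n\<close>, which bounds \<open>m + j\<close>.\<close>

lemma jacobi_pow_inner:
  assumes "m \<le> n" "j \<le> n"
  shows "(\<Sum>k\<le>n. jacobi_pow b l m k * (\<Prod>i=1..k. l i) * jacobi_pow b l j k) = jacobi_pow b l (m + j) 0"
proof -
  have "(\<Sum>k\<le>n. jacobi_pow b l m k * (\<Prod>i=1..k. l i) * jacobi_pow b l j k)
      = (\<Sum>k\<le>n + n. jacobi_pow b l m k * (\<Prod>i=1..k. l i) * jacobi_pow b l j k)"
    by (rule sum.mono_neutral_left) (use assms in \<open>auto simp: jacobi_pow_above\<close>)
  also have "\<dots> = jacobi_pow b l (m + j) 0"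
    by (rule jacobi_pow_inner_large) (use assms in simp)
  finally show ?thesis .
qed

section \<open>Path sums as entries of operator powers\<close>

text \<open>Weight of a step from \<open>j\<close> to \<open>k\<close>. The value 1 covers up steps
  and also jumps, so the product formula for \<open>wt\<close> holds for arbitrary
  \<open>\<omega>\<close>.\<close>

definition step_wt :: "nat \<Rightarrow> nat \<Rightarrow> zbl" where
  "step_wt j k = (if k = j then bvar j else if j = Suc k then lamvar j else 1)"

lemma wt_eq_prod_step_wt:
  "wt m \<omega> = (\<Prod>i=1..m. step_wt (\<omega> i) (\<omega> (i + 1)))"
proof -
  have "(\<Prod>i\<in>{i\<in>{1..m}. \<omega> (i+1) = \<omega> i}. bvar (\<omega> i))
      = (\<Prod>i=1..m. if \<omega> (i+1) = \<omega> i then bvar (\<omega> i) else 1)"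
    by (rule prod.inter_filter) simp
  moreover have "(\<Prod>j\<in>{j\<in>{1..m}. int (\<omega> (j+1)) - int (\<omega> j) = -1}. lamvar (\<omega> j))
      = (\<Prod>i=1..m. if int (\<omega> (i+1)) - int (\<omega> i) = -1 then lamvar (\<omega> i) else 1)"
    by (rule prod.inter_filter) simp
  ultimately show ?thesis
    unfolding wt_def by (simp only: prod.distrib[symmetric])
      (intro prod.cong, auto simp: step_wt_def)
qed

text \<open>A free end height permits recursion on the length; \<open>k = 0\<close> gives the paths
  summed in \<open>mu\<close>.\<close>

definition paths_to :: "nat \<Rightarrow> nat \<Rightarrow> (nat \<Rightarrow> nat) set" where
  "paths_to m k = {\<omega> \<in> motzkin_paths m. \<omega> 1 = 0 \<and> \<omega> (m + 1) = k}"

definition pathsum :: "nat \<Rightarrow> nat \<Rightarrow> zbl" where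
  "pathsum m k = (\<Sum>\<omega>\<in>paths_to m k. wt m \<omega>)"

lemma finite_paths_to: "finite (paths_to m k)"
proof (rule finite_subset)
  show "paths_to m k \<subseteq> {1..m+1} \<rightarrow>\<^sub>E {..m}"
  proof
    fix \<omega> assume "\<omega> \<in> paths_to m k"
    then have ext: "\<omega> \<in> {1..m+1} \<rightarrow>\<^sub>E UNIV" and start: "\<omega> 1 = 0"
      and step: "\<And>i. i \<in> {1..m} \<Longrightarrow> \<bar>int (\<omega> (i+1)) - int (\<omega> i)\<bar> \<le> 1"
      by (auto simp: paths_to_def motzkin_paths_def)
    have bound: "i \<le> m \<Longrightarrow> \<omega> (i+1) \<le> i" for i
    proof (induction i)
      case 0
      then show ?case using start by simp
    next
      case (Suc i)
      then show ?case using step[of "i+1"] by simp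
    qed
    have "\<omega> i \<in> {..m}" if "i \<in> {1..m+1}" for i
      using bound[of "i - 1"] that by (simp, linarith)
    then show "\<omega> \<in> {1..m+1} \<rightarrow>\<^sub>E {..m}"
      using ext by (auto simp: PiE_iff)
  qed
qed (rule finite_PiE; simp)

lemma pathsum_0: "pathsum 0 k = (if k = 0 then 1 else 0)"
proof -
  have "paths_to 0 k = (if k = 0 then {\<lambda>i. if i = 1 then 0 else undefined} else {})"
    by (auto simp: paths_to_def motzkin_paths_def PiE_iff extensional_def)
  then show ?thesis by (simp add: pathsum_def wt_def)
qed

text \<open>Cut off the last step: the height \<open>j\<close> before it is within 1 of
  \<open>k\<close>. For \<open>k = 0\<close> truncated subtraction leaves the range 0 to 1, as it
  should.\<close>

lemma pathsum_Suc_sum: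
  "pathsum (Suc m) k = (\<Sum>j\<in>{k - 1..k + 1}. pathsum m j * step_wt j k)"
proof -
  have "(\<Sum>j\<in>{k - 1..k + 1}. pathsum m j * step_wt j k)
      = (\<Sum>(j, \<omega>)\<in>Sigma {k - 1..k + 1} (paths_to m). wt m \<omega> * step_wt j k)"
    unfolding pathsum_def sum_distrib_right by (rule sum.Sigma) (simp_all add: finite_paths_to)
  also have "\<dots> = (\<Sum>\<omega>\<in>paths_to (Suc m) k. wt (Suc m) \<omega>)"
  \<comment> \<open>Position \<open>m + 2\<close> is the last one of a path of length
    \<open>Suc m\<close>. Appending writes \<open>k\<close> there; cutting restores
    \<open>undefined\<close>, as a path on the shorter domain requires.\<close>
  proof (rule sum.reindex_bij_witness[where
        i = "\<lambda>\<omega>. (\<omega> (m + 1), \<omega>(m + 2 := undefined))" and j = "\<lambda>(j, \<omega>). \<omega>(m + 2 := k)"])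
    fix a assume "a \<in> Sigma {k - 1..k + 1} (paths_to m)"
    then obtain j \<omega> where a: "a = (j, \<omega>)" and j: "k - 1 \<le> j" "j \<le> k + 1" and \<omega>: "\<omega> \<in> paths_to m j"
      by auto
    have undef: "\<omega> (m + 2) = undefined"
      using \<omega> by (auto simp: paths_to_def motzkin_paths_def PiE_iff extensional_def)
    have end_eq: "\<omega> (m + 1) = j"
      using \<omega> by (simp add: paths_to_def)
    show "((case a of (j, \<omega>) \<Rightarrow> \<omega>(m + 2 := k)) (m + 1),
        (case a of (j, \<omega>) \<Rightarrow> \<omega>(m + 2 := k))(m + 2 := undefined)) = a"
      using undef end_eq by (auto simp: a fun_eq_iff)
    have "\<bar>int ((\<omega>(m + 2 := k)) (i + 1)) - int ((\<omega>(m + 2 := k)) i)\<bar> \<le> 1" if "i \<in> {1..Suc m}" for i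
    proof (cases "i = m + 1")
      case True
      then show ?thesis using end_eq j by auto
    next
      case False
      then show ?thesis using that \<omega> by (auto simp: paths_to_def motzkin_paths_def)
    qed
    then show "(case a of (j, \<omega>) \<Rightarrow> \<omega>(m + 2 := k)) \<in> paths_to (Suc m) k"
      using \<omega> by (auto simp: a paths_to_def motzkin_paths_def PiE_iff extensional_def)
    have "wt (Suc m) (\<omega>(m + 2 := k)) = wt m \<omega> * step_wt j k"
      using end_eq by (simp add: wt_eq_prod_step_wt)
    then show "wt (Suc m) (case a of (j, \<omega>) \<Rightarrow> \<omega>(m + 2 := k))
        = (case a of (j, \<omega>) \<Rightarrow> wt m \<omega> * step_wt j k)"
      by (simp add: a)
  next
    fix \<omega> assume \<omega>: "\<omega> \<in> paths_to (Suc m) k"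
    then have step: "\<And>i. i \<in> {1..Suc m} \<Longrightarrow> \<bar>int (\<omega> (i+1)) - int (\<omega> i)\<bar> \<le> 1"
      and end_eq: "\<omega> (m + 2) = k"
      by (auto simp: paths_to_def motzkin_paths_def)
    show "(case (\<omega> (m + 1), \<omega>(m + 2 := undefined)) of (j, \<omega>) \<Rightarrow> \<omega>(m + 2 := k)) = \<omega>"
      using end_eq by auto
    have "\<omega>(m + 2 := undefined) \<in> paths_to m (\<omega> (m + 1))"
      using \<omega> by (auto simp: paths_to_def motzkin_paths_def PiE_iff extensional_def)
    moreover have "\<omega> (m + 1) \<in> {k - 1..k + 1}"
      using step[of "m + 1"] end_eq by auto
    ultimately show "(\<omega> (m + 1), \<omega>(m + 2 := undefined)) \<in> Sigma {k - 1..k + 1} (paths_to m)"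
      by blast
  qed
  finally show ?thesis by (simp add: pathsum_def)
qed

text \<open>The terms of \<open>jacobi\<close> are the possible last steps; no up step ends at
  height 0, whence the case distinction.\<close>

lemma pathsum_Suc: "pathsum (Suc m) k = jacobi bvar lamvar (pathsum m) k"
proof (cases k)
  case 0
  then have "{k - 1..k + 1} = {0, 1}" by auto
  with 0 show ?thesis
    by (simp add: pathsum_Suc_sum jacobi_def step_wt_def mult.commute)
next
  case (Suc k')
  then have "{k - 1..k + 1} = {k', Suc k', Suc (Suc k')}" by auto
  with Suc show ?thesis
    by (simp add: pathsum_Suc_sum jacobi_def step_wt_def mult.commute add.assoc add.left_commute)
qed

lemma pathsum_eq_jacobi_pow: "pathsum m = jacobi_pow bvar lamvar m"
proof (induction m)
  case 0
  show ?case by (rule ext) (simp add: pathsum_0 jacobi_pow_0)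
next
  case (Suc m)
  show ?case by (rule ext) (simp add: pathsum_Suc jacobi_pow_Suc Suc.IH)
qed

lemma mu_eq_jacobi_pow: "mu m = jacobi_pow bvar lamvar m 0"
  by (simp add: mu_def pathsum_eq_jacobi_pow[symmetric] pathsum_def paths_to_def)

section \<open>The functional on products of polynomials\<close>

lemma Lfun_sum: "finite I \<Longrightarrow> Lfun (\<Sum>i\<in>I. p i) = (\<Sum>i\<in>I. Lfun (p i))"
  by (induction I rule: finite_induct) (simp_all add: Lfun_add, simp add: Lfun_def)

lemma Lfun_mult:
  assumes "degree f \<le> n" "degree g \<le> n"
  shows "Lfun (f * g) = (\<Sum>i\<le>n. \<Sum>j\<le>n. coeff f i * coeff g j * mu (i + j))"
proof -
  have monom: "Lfun (monom c m) = c * mu m" for c m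
    using Lfun_smult[of c "monom 1 m"] by (simp add: Lfun_monom smult_monom)
  have "f * g = (\<Sum>i\<le>n. monom (coeff f i) i) * (\<Sum>j\<le>n. monom (coeff g j) j)"
    by (simp add: poly_as_sum_of_monoms' assms)
  also have "\<dots> = (\<Sum>i\<le>n. \<Sum>j\<le>n. monom (coeff f i * coeff g j) (i + j))"
    by (simp add: sum_product mult_monom)
  finally show ?thesis by (simp add: Lfun_sum monom)
qed

text \<open>The entries of \<open>f(J) e\<^sub>0\<close>.\<close>

definition expansion :: "zbl poly \<Rightarrow> nat \<Rightarrow> zbl" where
  "expansion f k = (\<Sum>i\<le>degree f. coeff f i * jacobi_pow bvar lamvar i k)"

lemma expansion_above: "degree f < k \<Longrightarrow> expansion f k = 0"
  by (simp add: expansion_def jacobi_pow_above)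

text \<open>Among the powers involved only the top one reaches this entry, with value 1.\<close>

lemma expansion_degree: "expansion f (degree f) = lead_coeff f"
proof -
  have "expansion f (degree f) = (\<Sum>i\<le>degree f. if i = degree f then lead_coeff f else 0)"
    unfolding expansion_def by (intro sum.cong) (auto simp: jacobi_pow_diag jacobi_pow_above)
  then show ?thesis by simp
qed

lemma expansion_altdef:
  assumes "degree f \<le> n"
  shows "expansion f k = (\<Sum>i\<le>n. coeff f i * jacobi_pow bvar lamvar i k)"
  unfolding expansion_def
  by (rule sum.mono_neutral_left) (use assms in \<open>auto simp: coeff_eq_0\<close>)

text \<open>Bilinear extension of \<open>jacobi_pow_inner\<close> from powers of x to polynomials;
  this is the matrix factorization, entry by entry.\<close>

lemma Lfun_mult_expansion:
  assumes "degree f \<le> n" "degree g \<le> n"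
  shows "Lfun (f * g) = (\<Sum>k\<le>n. expansion f k * (\<Prod>i=1..k. lamvar i) * expansion g k)"
proof -
  let ?T = "jacobi_pow bvar lamvar" and ?\<Lambda> = "\<lambda>k. \<Prod>i=1..k. lamvar i"
  have "Lfun (f * g) = (\<Sum>i\<le>n. \<Sum>j\<le>n. \<Sum>k\<le>n. coeff f i * coeff g j * (?T i k * ?\<Lambda> k * ?T j k))"
    unfolding Lfun_mult[OF assms] sum_distrib_left[symmetric]
    by (intro sum.cong refl) (simp add: mu_eq_jacobi_pow jacobi_pow_inner[symmetric] del: One_nat_def)
  \<comment> \<open>Once the sum over \<open>k\<close> is outermost, the sums over \<open>i\<close>
    and \<open>j\<close> separate into the two expansions.\<close>
  also have "\<dots> = (\<Sum>i\<le>n. \<Sum>k\<le>n. \<Sum>j\<le>n. coeff f i * coeff g j * (?T i k * ?\<Lambda> k * ?T j k))"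
    by (rule sum.cong[OF refl]) (rule sum.swap)
  also have "\<dots> = (\<Sum>k\<le>n. \<Sum>i\<le>n. \<Sum>j\<le>n. coeff f i * coeff g j * (?T i k * ?\<Lambda> k * ?T j k))"
    by (rule sum.swap)
  also have "\<dots> = (\<Sum>k\<le>n. \<Sum>i\<le>n. \<Sum>j\<le>n. (coeff f i * ?T i k) * ?\<Lambda> k * (coeff g j * ?T j k))"
    by (intro sum.cong refl) (simp add: ac_simps)
  also have "\<dots> = (\<Sum>k\<le>n. expansion f k * ?\<Lambda> k * expansion g k)"
    unfolding expansion_altdef[OF assms(1)] expansion_altdef[OF assms(2)]
    by (simp only: sum_product[symmetric] sum_distrib_right[symmetric])
  finally show ?thesis .
qed

section \<open>Matrices of determinant one\<close>

text \<open>Since the determinant is 1, the adjugate is a two-sided inverse over any commutative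
  ring; multiplicativity gives its determinant.\<close>

lemma adj_mat_SL:
  assumes "U \<in> SL n"
  shows "adj_mat U \<in> SL n" "adj_mat U * U = 1\<^sub>m n" "U * adj_mat U = 1\<^sub>m n"
proof -
  have U: "U \<in> carrier_mat n n" "det U = 1" using assms by (auto simp: SL_def)
  note adj = adj_mat[OF U(1)]
  show inv: "adj_mat U * U = 1\<^sub>m n" "U * adj_mat U = 1\<^sub>m n"
    unfolding adj(2,3) U(2) by (rule eq_matI; simp)+
  have "det (adj_mat U) * det U = det (1\<^sub>m n :: 'a mat)"
    using det_mult[OF adj(1) U(1)] inv(1) by simp
  then show "adj_mat U \<in> SL n" using adj U by (simp add: SL_def)
qed

text \<open>The adjugates of the outer factors invert them and serve as the witnesses in
  \<open>is_SSNF\<close>.\<close>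

lemma is_SSNF_factorization:
  fixes U V D :: "'a::comm_ring_1 mat"
  assumes U: "U \<in> SL m" and V: "V \<in> SL n" and D: "D \<in> carrier_mat m n" "diagonal_mat D"
    and dvd: "\<And>i j. i < min m n \<Longrightarrow> j \<le> i \<Longrightarrow> D $$ (j,j) dvd D $$ (i,i)"
  shows "is_SSNF (U * D * V) D"
proof -
  note c = U V adj_mat_SL(1)[OF U] adj_mat_SL(1)[OF V]
  have carrier: "U \<in> carrier_mat m m" "V \<in> carrier_mat n n"
    "adj_mat U \<in> carrier_mat m m" "adj_mat V \<in> carrier_mat n n"
    using c by (simp_all add: SL_def)
  have UD: "U * D \<in> carrier_mat m n" using carrier D by simp
  have "adj_mat U * (U * D * V) * adj_mat V = adj_mat U * (U * D * V * adj_mat V)"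
    by (rule assoc_mult_mat) (use carrier UD in auto)
  also have "U * D * V * adj_mat V = U * D * (V * adj_mat V)"
    by (rule assoc_mult_mat) (use carrier UD in auto)
  also have "\<dots> = U * D" using adj_mat_SL(3)[OF V] right_mult_one_mat[OF UD] by simp
  also have "adj_mat U * (U * D) = adj_mat U * U * D"
    by (rule assoc_mult_mat[symmetric]) (use carrier D in auto)
  also have "\<dots> = D" using D adj_mat_SL(2)[OF U] by simp
  finally have "adj_mat U * (U * D * V) * adj_mat V = D" .
  moreover have "dim_row (U * D * V) = m" "dim_col (U * D * V) = n" using carrier by auto
  ultimately show ?thesis
    unfolding is_SSNF_def using c D dvd by auto
qed

lemma lower_unitriangular_SL:
  assumes "\<And>i j. i < j \<Longrightarrow> j < n \<Longrightarrow> f i j = 0" "\<And>i. i < n \<Longrightarrow> f i i = 1"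
  shows "mat n n (\<lambda>(i,j). f i j) \<in> SL n"
proof -
  let ?U = "mat n n (\<lambda>(i,j). f i j)"
  have "det ?U = prod_list (diag_mat ?U)"
    by (rule det_lower_triangular[of n]) (use assms in auto)
  also have "diag_mat ?U = map (\<lambda>_. 1) [0..<n]"
    using assms by (auto simp: diag_mat_def)
  also have "prod_list \<dots> = (1 :: 'a)"
    by (simp add: map_replicate_const)
  finally show ?thesis by (simp add: SL_def)
qed

lemma transpose_SL: "U \<in> SL n \<Longrightarrow> transpose_mat U \<in> SL n"
  by (auto simp: SL_def det_transpose)

section \<open>Factorization of the moment matrix\<close>

lemma expansion_mat_SL:
  assumes "\<And>k. k \<le> n \<Longrightarrow> lead_coeff (Y k) = 1 \<and> degree (Y k) = k"
  shows "mat (n + 1) (n + 1) (\<lambda>(i,j). expansion (Y i) j) \<in> SL (n + 1)"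
proof (rule lower_unitriangular_SL)
  show "expansion (Y i) j = 0" if "i < j" "j < n + 1" for i j
    using that assms[of i] by (simp add: expansion_above)
  show "expansion (Y i) i = 1" if "i < n + 1" for i
    using that assms[of i] expansion_degree[of "Y i"] by auto
qed

theorem theorem7p2:
  fixes n :: nat and Y Z :: "nat \<Rightarrow> zbl poly"
  assumes "\<And>k. k \<le> n \<Longrightarrow> lead_coeff (Y k) = 1 \<and> degree (Y k) = k"
    and "\<And>k. k \<le> n \<Longrightarrow> lead_coeff (Z k) = 1 \<and> degree (Z k) = k"
  shows "is_SSNF (mat (n+1) (n+1) (\<lambda>(i,j). Lfun (Y i * Z j)))
                 (mat_diag (n+1) (\<lambda>k. \<Prod>i=1..k. lamvar i))"
proof -
  define U where "U = mat (n+1) (n+1) (\<lambda>(i,j). expansion (Y i) j)"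
  define V where "V = mat (n+1) (n+1) (\<lambda>(i,j). expansion (Z i) j)"
  define D where "D = mat_diag (n+1) (\<lambda>k. \<Prod>i=1..k. lamvar i)"
  have SL: "U \<in> SL (n+1)" "transpose_mat V \<in> SL (n+1)"
    unfolding U_def V_def by (intro transpose_SL expansion_mat_SL assms; assumption)+
  have carrier: "U \<in> carrier_mat (n+1) (n+1)" by (simp add: U_def)
  have UD: "U * D = mat (n+1) (n+1) (\<lambda>(i,j). U $$ (i,j) * (\<Prod>k=1..j. lamvar k))"
    unfolding D_def by (rule mat_diag_mult_right[OF carrier])
  have "mat (n+1) (n+1) (\<lambda>(i,j). Lfun (Y i * Z j)) = U * D * transpose_mat V"
  proof (rule eq_matI)
    fix i j assume "i < dim_row (U * D * transpose_mat V)" "j < dim_col (U * D * transpose_mat V)"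
    then have i: "i < n + 1" and j: "j < n + 1" by (simp_all add: U_def V_def)
    \<comment> \<open>The bound \<open>n\<close>, common to all entries, makes the sum run over
      exactly the inner indices of the matrix product.\<close>
    have "Lfun (Y i * Z j) = (\<Sum>k\<le>n. expansion (Y i) k * (\<Prod>i=1..k. lamvar i) * expansion (Z j) k)"
      by (rule Lfun_mult_expansion) (use assms i j in auto)
    also have "\<dots> = (U * D * transpose_mat V) $$ (i, j)"
      using i j unfolding UD
      by (simp add: U_def V_def scalar_prod_def atLeast0LessThan lessThan_Suc_atMost)
    finally show "mat (n+1) (n+1) (\<lambda>(i,j). Lfun (Y i * Z j)) $$ (i, j)
        = (U * D * transpose_mat V) $$ (i, j)"
      using i j by simp
  qed (simp_all add: U_def V_def)
  moreover have "is_SSNF (U * D * transpose_mat V) D"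
  proof (rule is_SSNF_factorization[OF SL])
    show "D \<in> carrier_mat (n+1) (n+1)" "diagonal_mat D"
      by (auto simp: D_def diagonal_mat_def mat_diag_def)
    \<comment> \<open>The factors of entry \<open>j\<close> are among those of entry
      \<open>i\<close>.\<close>
    show "D $$ (j,j) dvd D $$ (i,i)" if "i < min (n+1) (n+1)" "j \<le> i" for i j
      using that by (auto simp: D_def mat_diag_def intro!: prod_dvd_prod_subset)
  qed
  ultimately show ?thesis by (simp add: D_def)
qed

end
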